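(* (Green's function for general two-point BVPs.) Let $a<b$ with $[a,b]\subseteq\mathcal I$ and let $\xi,\beta,\gamma,\delta\in\mathbb R$. Assume that the homogeneous boundary value problem $$Lx=0,\qquad \xi x(a)-\beta D^{\alpha}x(a)=0,\qquad \gamma x(b)+\delta D^{\alpha}x(b)=0 \qquad(\ast)$$ has only the trivial solution. For each fixed $s\in[a,b]$, let $u(\cdot,s)$ be the unique solution of the boundary value problem $$Lu(\cdot,s)=0,\qquad \xi u(a,s)-\beta D^{\alpha}u(a,s)=0,\qquad \gamma u(b,s)+\delta D^{\alpha}u(b,s)=-\gamma x(b,s)-\delta D^{\alpha}x(b,s),$$ where $x(t,s)$ is the Cauchy function for $Lx=0$. Define Green's function $G:[a,b]\times[a,b]\to\mathbb R$ for $(\ast)$ by $$G(t,s)=\begin{cases}u(t,s)&: a\le t\le s\le b,\\ v(t,s)&: a\le s\le t\le b,\end{cases}$$ where $v(t,s):=u(t,s)+x(t,s)$ for $t,s\in[a,b]$. Then for each fixed $s\in[a,b]$, $v(\cdot,s)$ is a solution of $Lx=0$ and satisfies the second boundary condition in $(\ast)$, i.e. $\gamma v(b,s)+\delta D^{\alpha}v(b,s)=0$. If $h$ is continuous on $[a,b]$, then $$x(t):=\int_a^bG(t,s)h(s)\,d_\alpha s$$ is the (unique) solution of the nonhomogeneous boundary value problem $$Lx=h(t),\qquad \xi x(a)-\beta D^{\alpha}x(a)=0,\qquad \gamma x(b)+\delta D^{\alpha}x(b)=0.$$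
   Context: $\mathcal I\subseteq\mathbb R$ is a nondegenerate interval. The functions $\kappa_0,\kappa_1:[0,1]\times\mathcal I\to[0,\infty)$ are continuous and satisfy, for all $t\in\mathcal I$: $\lim_{\alpha\to0^+}\kappa_1(\alpha,t)=1$, $\lim_{\alpha\to0^+}\kappa_0(\alpha,t)=0$, $\lim_{\alpha\to1^-}\kappa_1(\alpha,t)=0$, $\lim_{\alpha\to1^-}\kappa_0(\alpha,t)=1$, $\kappa_1(\alpha,t)\ne0$ for $\alpha\in[0,1)$, and $\kappa_0(\alpha,t)\neq0$ for $\alpha\in(0,1]$. Fix $\alpha\in(0,1]$ and write $\kappa_j(t)=\kappa_j(\alpha,t)$. The conformable (proportional) derivative is $D^{\alpha}f(t)=\kappa_1(t)f(t)+\kappa_0(t)f'(t)$; for functions of $(t,s)$ it acts on the first variable, and e.g. $D^{\alpha}u(b,s)$ means the derivative of $u(\cdot,s)$ evaluated at $b$. Write $d_\alpha s=ds/\kappa_0(s)$. Let $p,q$ be continuous on $\mathcal I$ with $p(t)>0$ for all $t\in\mathcal I$, and set $Lx=D^{\alpha}[pD^{\alpha}x]+qx$. A solution of $Lx=h$ is a continuous function $x$ such that $D^{\alpha}x$ and $D^{\alpha}[pD^{\alpha}x]$ exist and are continuous and $Lx=h$ holds at every point of the interval considered. The Cauchy function $x(t,s)$ for $Lx=0$ is defined by: for each fixed $s$, $x(\cdot,s)$ is the solution of the initial value problem $Lx(\cdot,s)=0$, $x(s,s)=0$, $D^{\alpha}x(s,s)=1/p(s)$. *)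

theory Defs
  imports "HOL-Analysis.Analysis"
begin

text \<open>
  Functions on an interval are total functions of which only the values on that interval matter.
  Derivatives are taken within the interval \<open>J\<close> on which a function is considered, hence are
  one-sided at endpoints of \<open>J\<close> belonging to \<open>J\<close>.
\<close>

definition nondegenerate_interval :: "real set \<Rightarrow> bool" where
  "nondegenerate_interval I \<longleftrightarrow> is_interval I \<and> (\<exists>c\<in>I. \<exists>d\<in>I. c < d)"

definition conformable_kernels ::
    "real set \<Rightarrow> (real \<Rightarrow> real \<Rightarrow> real) \<Rightarrow> (real \<Rightarrow> real \<Rightarrow> real) \<Rightarrow> bool" where
  "conformable_kernels I \<kappa>0 \<kappa>1 \<longleftrightarrow>
     continuous_on ({0..1} \<times> I) (\<lambda>(\<alpha>, t). \<kappa>0 \<alpha> t) \<and>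
     continuous_on ({0..1} \<times> I) (\<lambda>(\<alpha>, t). \<kappa>1 \<alpha> t) \<and>
     (\<forall>\<alpha>\<in>{0..1}. \<forall>t\<in>I. 0 \<le> \<kappa>0 \<alpha> t \<and> 0 \<le> \<kappa>1 \<alpha> t) \<and>
     (\<forall>t\<in>I.
        ((\<lambda>\<alpha>. \<kappa>1 \<alpha> t) \<longlongrightarrow> 1) (at_right 0) \<and>
        ((\<lambda>\<alpha>. \<kappa>0 \<alpha> t) \<longlongrightarrow> 0) (at_right 0) \<and>
        ((\<lambda>\<alpha>. \<kappa>1 \<alpha> t) \<longlongrightarrow> 0) (at_left 1) \<and>
        ((\<lambda>\<alpha>. \<kappa>0 \<alpha> t) \<longlongrightarrow> 1) (at_left 1) \<and>
        (\<forall>\<alpha>\<in>{0..<1}. \<kappa>1 \<alpha> t \<noteq> 0) \<and>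
        (\<forall>\<alpha>\<in>{0<..1}. \<kappa>0 \<alpha> t \<noteq> 0))"

definition conf_deriv ::
    "(real \<Rightarrow> real \<Rightarrow> real) \<Rightarrow> (real \<Rightarrow> real \<Rightarrow> real) \<Rightarrow> real \<Rightarrow> real set \<Rightarrow>
     (real \<Rightarrow> real) \<Rightarrow> real \<Rightarrow> real" where
  "conf_deriv \<kappa>0 \<kappa>1 \<alpha> J f t =
     \<kappa>1 \<alpha> t * f t + \<kappa>0 \<alpha> t * vector_derivative f (at t within J)"

definition conf_SL_op ::
    "(real \<Rightarrow> real \<Rightarrow> real) \<Rightarrow> (real \<Rightarrow> real \<Rightarrow> real) \<Rightarrow> real \<Rightarrow> (real \<Rightarrow> real) \<Rightarrow> (real \<Rightarrow> real) \<Rightarrow>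
     real set \<Rightarrow> (real \<Rightarrow> real) \<Rightarrow> real \<Rightarrow> real" where
  "conf_SL_op \<kappa>0 \<kappa>1 \<alpha> p q J y t =
     conf_deriv \<kappa>0 \<kappa>1 \<alpha> J (\<lambda>r. p r * conf_deriv \<kappa>0 \<kappa>1 \<alpha> J y r) t + q t * y t"

text \<open>
  For \<open>0 < \<alpha> \<le> 1\<close> the kernel \<open>\<kappa>0 \<alpha>\<close> does not vanish, so the conformable derivative of a
  function exists on \<open>J\<close> precisely when the function is differentiable on \<open>J\<close>.
\<close>

definition SL_solution ::
    "(real \<Rightarrow> real \<Rightarrow> real) \<Rightarrow> (real \<Rightarrow> real \<Rightarrow> real) \<Rightarrow> real \<Rightarrow> (real \<Rightarrow> real) \<Rightarrow> (real \<Rightarrow> real) \<Rightarrow>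
     real set \<Rightarrow> (real \<Rightarrow> real) \<Rightarrow> (real \<Rightarrow> real) \<Rightarrow> bool" where
  "SL_solution \<kappa>0 \<kappa>1 \<alpha> p q J h y \<longleftrightarrow>
     (let Dy = conf_deriv \<kappa>0 \<kappa>1 \<alpha> J y; pDy = (\<lambda>r. p r * Dy r) in
      continuous_on J y \<and>
      y differentiable_on J \<and> continuous_on J Dy \<and>
      pDy differentiable_on J \<and> continuous_on J (conf_deriv \<kappa>0 \<kappa>1 \<alpha> J pDy) \<and>
      (\<forall>t\<in>J. conf_SL_op \<kappa>0 \<kappa>1 \<alpha> p q J y t = h t))"

text \<open>In \<open>x t s\<close> (and likewise \<open>u t s\<close>, \<open>v t s\<close> below) operators act on the first variable \<open>t\<close>.\<close>

definition Cauchy_function ::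
    "(real \<Rightarrow> real \<Rightarrow> real) \<Rightarrow> (real \<Rightarrow> real \<Rightarrow> real) \<Rightarrow> real \<Rightarrow> (real \<Rightarrow> real) \<Rightarrow> (real \<Rightarrow> real) \<Rightarrow>
     real set \<Rightarrow> (real \<Rightarrow> real \<Rightarrow> real) \<Rightarrow> bool" where
  "Cauchy_function \<kappa>0 \<kappa>1 \<alpha> p q I x \<longleftrightarrow>
     (\<forall>s\<in>I. SL_solution \<kappa>0 \<kappa>1 \<alpha> p q I (\<lambda>_. 0) (\<lambda>t. x t s) \<and>
            x s s = 0 \<and>
            conf_deriv \<kappa>0 \<kappa>1 \<alpha> I (\<lambda>t. x t s) s = 1 / p s)"

text \<open>
  \<open>y\<close> solves \<open>L y = h\<close> on \<open>[a, b]\<close> with boundary values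
  \<open>\<xi> y(a) - \<beta> D y(a) = A\<close> and \<open>\<gamma> y(b) + \<delta> D y(b) = B\<close>.
\<close>

definition BVP_solution ::
    "(real \<Rightarrow> real \<Rightarrow> real) \<Rightarrow> (real \<Rightarrow> real \<Rightarrow> real) \<Rightarrow> real \<Rightarrow> (real \<Rightarrow> real) \<Rightarrow> (real \<Rightarrow> real) \<Rightarrow>
     real \<Rightarrow> real \<Rightarrow> real \<Rightarrow> real \<Rightarrow> real \<Rightarrow> real \<Rightarrow>
     (real \<Rightarrow> real) \<Rightarrow> real \<Rightarrow> real \<Rightarrow> (real \<Rightarrow> real) \<Rightarrow> bool" where
  "BVP_solution \<kappa>0 \<kappa>1 \<alpha> p q a b \<xi> \<beta> \<gamma> \<delta> h A B y \<longleftrightarrow>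
     SL_solution \<kappa>0 \<kappa>1 \<alpha> p q {a..b} h y \<and>
     \<xi> * y a - \<beta> * conf_deriv \<kappa>0 \<kappa>1 \<alpha> {a..b} y a = A \<and>
     \<gamma> * y b + \<delta> * conf_deriv \<kappa>0 \<kappa>1 \<alpha> {a..b} y b = B"

definition unique_BVP_solution ::
    "(real \<Rightarrow> real \<Rightarrow> real) \<Rightarrow> (real \<Rightarrow> real \<Rightarrow> real) \<Rightarrow> real \<Rightarrow> (real \<Rightarrow> real) \<Rightarrow> (real \<Rightarrow> real) \<Rightarrow>
     real \<Rightarrow> real \<Rightarrow> real \<Rightarrow> real \<Rightarrow> real \<Rightarrow> real \<Rightarrow>
     (real \<Rightarrow> real) \<Rightarrow> real \<Rightarrow> real \<Rightarrow> (real \<Rightarrow> real) \<Rightarrow> bool" where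
  "unique_BVP_solution \<kappa>0 \<kappa>1 \<alpha> p q a b \<xi> \<beta> \<gamma> \<delta> h A B y \<longleftrightarrow>
     BVP_solution \<kappa>0 \<kappa>1 \<alpha> p q a b \<xi> \<beta> \<gamma> \<delta> h A B y \<and>
     (\<forall>z. BVP_solution \<kappa>0 \<kappa>1 \<alpha> p q a b \<xi> \<beta> \<gamma> \<delta> h A B z \<longrightarrow> (\<forall>t\<in>{a..b}. z t = y t))"

text \<open>
  The two branches overlap on the diagonal; they agree there because the Cauchy function
  satisfies \<open>x s s = 0\<close>.
\<close>

definition Green_function ::
    "(real \<Rightarrow> real \<Rightarrow> real) \<Rightarrow> (real \<Rightarrow> real \<Rightarrow> real) \<Rightarrow> real \<Rightarrow> real \<Rightarrow> real" where
  "Green_function u v t s = (if t \<le> s then u t s else v t s)"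

end

theory Submission
  imports Defs
begin

text \<open>
  Two Cauchy functions \<open>y1 = x(\<cdot>, a)\<close> and \<open>y2 = x(\<cdot>, c)\<close> with \<open>x(c, a) \<noteq> 0\<close> have a nonvanishing
  Wronskian \<open>W = y1 (p D y2) - (p D y1) y2\<close>, hence span the solution space, and
  \<open>x(t, s) = (y1(s) y2(t) - y2(s) y1(t)) / W(s)\<close>. Let \<open>\<phi>\<close> be a nontrivial combination of them
  satisfying the boundary condition at \<open>a\<close>. Triviality of the homogeneous problem says that the
  boundary functional at \<open>b\<close> does not vanish on \<open>\<phi>\<close>, so \<open>u(\<cdot>, s)\<close> is the multiple of \<open>\<phi>\<close>
  prescribed by its value there. With \<open>s\<close> and \<open>t\<close> thus separated, the integral of
  \<open>G(t, s) h(s)\<close> is a multiple of \<open>\<phi>\<close> plus the variation of constants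
  formula, and the boundary value at \<open>b\<close> of the former cancels that of the latter.
\<close>

section \<open>Reduction to a first-order system\<close>

text \<open>The definition of the conformable derivative is solved for the ordinary derivative, once
  for \<open>y\<close> and once for \<open>z = p D y\<close>. The set \<open>J\<close> stays
  arbitrary to cover Cauchy functions on \<open>I\<close> as well as boundary value problems on
  \<open>{a..b}\<close>.\<close>

lemma SL_solution_imp_derivs:
  fixes y :: "real \<Rightarrow> real"
  assumes sol: "SL_solution \<kappa>0 \<kappa>1 \<alpha> p q J h y" and t: "t \<in> J"
    and "\<kappa>0 \<alpha> t \<noteq> 0" "p t \<noteq> 0"
  defines "z \<equiv> \<lambda>r. p r * conf_deriv \<kappa>0 \<kappa>1 \<alpha> J y r"
  shows "(y has_real_derivative (z t / p t - \<kappa>1 \<alpha> t * y t) / \<kappa>0 \<alpha> t) (at t within J)"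
    and "(z has_real_derivative (h t - q t * y t - \<kappa>1 \<alpha> t * z t) / \<kappa>0 \<alpha> t) (at t within J)"
proof -
  have "y differentiable (at t within J)" "z differentiable (at t within J)"
    and eq: "conf_SL_op \<kappa>0 \<kappa>1 \<alpha> p q J y t = h t"
    using sol t by (auto simp: SL_solution_def Let_def differentiable_on_def z_def)
  then have y: "(y has_real_derivative vector_derivative y (at t within J)) (at t within J)"
    and z: "(z has_real_derivative vector_derivative z (at t within J)) (at t within J)"
    by (auto simp: vector_derivative_works has_real_derivative_iff_has_vector_derivative)
  have "vector_derivative y (at t within J) = (z t / p t - \<kappa>1 \<alpha> t * y t) / \<kappa>0 \<alpha> t"
    using assms(3,4) by (simp add: z_def conf_deriv_def field_simps)
  with y show "(y has_real_derivative (z t / p t - \<kappa>1 \<alpha> t * y t) / \<kappa>0 \<alpha> t) (at t within J)"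
    by simp
  have "\<kappa>1 \<alpha> t * z t + \<kappa>0 \<alpha> t * vector_derivative z (at t within J) + q t * y t = h t"
    using eq unfolding conf_SL_op_def z_def[symmetric] by (simp only: conf_deriv_def)
  then have "vector_derivative z (at t within J) = (h t - q t * y t - \<kappa>1 \<alpha> t * z t) / \<kappa>0 \<alpha> t"
    using assms(3) by (simp add: field_simps)
  with z show "(z has_real_derivative (h t - q t * y t - \<kappa>1 \<alpha> t * z t) / \<kappa>0 \<alpha> t) (at t within J)"
    by simp
qed

locale SL_interval =
  fixes \<kappa>0 \<kappa>1 :: "real \<Rightarrow> real \<Rightarrow> real" and \<alpha> :: real and p q :: "real \<Rightarrow> real" and a b :: real
  assumes ab: "a < b"
    and cont_\<kappa>0: "continuous_on {a..b} (\<kappa>0 \<alpha>)"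
    and cont_\<kappa>1: "continuous_on {a..b} (\<kappa>1 \<alpha>)"
    and cont_p: "continuous_on {a..b} p"
    and cont_q: "continuous_on {a..b} q"
    and \<kappa>0_nz: "\<And>t. t \<in> {a..b} \<Longrightarrow> \<kappa>0 \<alpha> t \<noteq> 0"
    and p_nz: "\<And>t. t \<in> {a..b} \<Longrightarrow> p t \<noteq> 0"
begin

text \<open>The equation \<open>L y = h\<close> as a first-order system for \<open>y\<close> and \<open>z = p D y\<close>.\<close>

definition SL_system :: "(real \<Rightarrow> real) \<Rightarrow> (real \<Rightarrow> real) \<Rightarrow> (real \<Rightarrow> real) \<Rightarrow> bool" where
  "SL_system h y z \<longleftrightarrow> (\<forall>t\<in>{a..b}.
     (y has_real_derivative (z t / p t - \<kappa>1 \<alpha> t * y t) / \<kappa>0 \<alpha> t) (at t within {a..b}) \<and>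
     (z has_real_derivative (h t - q t * y t - \<kappa>1 \<alpha> t * z t) / \<kappa>0 \<alpha> t) (at t within {a..b}))"

lemma SL_system_cont:
  assumes "SL_system h y z"
  shows "continuous_on {a..b} y" "continuous_on {a..b} z"
  by (rule DERIV_continuous_on, use assms[unfolded SL_system_def] in blast)+

lemma SL_system_cong:
  assumes "SL_system h y z" "\<And>t. t \<in> {a..b} \<Longrightarrow> y' t = y t" "\<And>t. t \<in> {a..b} \<Longrightarrow> z' t = z t"
    "\<And>t. t \<in> {a..b} \<Longrightarrow> h' t = h t"
  shows "SL_system h' y' z'"
  unfolding SL_system_def
proof (intro ballI conjI)
  fix t assume t: "t \<in> {a..b}"
  show "(y' has_real_derivative (z' t / p t - \<kappa>1 \<alpha> t * y' t) / \<kappa>0 \<alpha> t) (at t within {a..b})"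
    unfolding has_field_derivative_def
    by (rule has_derivative_transform[OF t])
       (use assms t in \<open>auto simp: SL_system_def has_field_derivative_def\<close>)
  show "(z' has_real_derivative (h' t - q t * y' t - \<kappa>1 \<alpha> t * z' t) / \<kappa>0 \<alpha> t) (at t within {a..b})"
    unfolding has_field_derivative_def
    by (rule has_derivative_transform[OF t])
       (use assms t in \<open>auto simp: SL_system_def has_field_derivative_def\<close>)
qed

lemma SL_system_linear:
  assumes "SL_system h y z" "SL_system g y' z'"
  shows "SL_system (\<lambda>t. c * h t + d * g t) (\<lambda>t. c * y t + d * y' t) (\<lambda>t. c * z t + d * z' t)"
  unfolding SL_system_def
proof (intro ballI conjI)
  fix t assume t: "t \<in> {a..b}"
  note D = assms[unfolded SL_system_def, rule_format, OF t]
  note [derivative_intros] = D(1)[THEN conjunct1] D(1)[THEN conjunct2]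
    D(2)[THEN conjunct1] D(2)[THEN conjunct2]
  show "((\<lambda>t. c * y t + d * y' t) has_real_derivative
      ((c * z t + d * z' t) / p t - \<kappa>1 \<alpha> t * (c * y t + d * y' t)) / \<kappa>0 \<alpha> t) (at t within {a..b})"
    by (auto intro!: derivative_eq_intros simp: \<kappa>0_nz[OF t] p_nz[OF t] field_simps)
  show "((\<lambda>t. c * z t + d * z' t) has_real_derivative
      (c * h t + d * g t - q t * (c * y t + d * y' t) - \<kappa>1 \<alpha> t * (c * z t + d * z' t)) / \<kappa>0 \<alpha> t)
      (at t within {a..b})"
    by (auto intro!: derivative_eq_intros simp: \<kappa>0_nz[OF t] field_simps)
qed

text \<open>Derivatives within a nondegenerate closed interval are unique, so the one in the system
  is the one inside \<open>conf_deriv\<close>. Hence \<open>y\<close> determines \<open>z\<close> on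
  \<open>[a, b]\<close>.\<close>

lemma SL_system_conf_deriv:
  assumes "SL_system h y z" "t \<in> {a..b}"
  shows "conf_deriv \<kappa>0 \<kappa>1 \<alpha> {a..b} y t = z t / p t"
proof -
  have "vector_derivative y (at t within {a..b}) = (z t / p t - \<kappa>1 \<alpha> t * y t) / \<kappa>0 \<alpha> t"
    using assms ab
    by (intro vector_derivative_within_closed_interval)
       (auto simp: SL_system_def has_real_derivative_iff_has_vector_derivative)
  then show ?thesis using \<kappa>0_nz[OF assms(2)] by (simp add: conf_deriv_def)
qed

text \<open>The continuity demanded of a solution comes from the system: on \<open>[a, b]\<close>
  the two conformable derivatives are \<open>z / p\<close> and \<open>h - q y\<close>.\<close>

lemma SL_system_imp_solution:
  assumes sys: "SL_system h y z" and h: "continuous_on {a..b} h"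
  shows "SL_solution \<kappa>0 \<kappa>1 \<alpha> p q {a..b} h y"
proof -
  let ?Dy = "conf_deriv \<kappa>0 \<kappa>1 \<alpha> {a..b} y"
  note cont = SL_system_cont[OF sys]
  have pDy: "p t * ?Dy t = z t" if "t \<in> {a..b}" for t
    using SL_system_conf_deriv[OF sys that] p_nz[OF that] by simp
  have dpDy: "((\<lambda>r. p r * ?Dy r) has_real_derivative
      (h t - q t * y t - \<kappa>1 \<alpha> t * z t) / \<kappa>0 \<alpha> t) (at t within {a..b})" if "t \<in> {a..b}" for t
    unfolding has_field_derivative_def
    by (rule has_derivative_transform[OF that pDy])
       (use sys that in \<open>auto simp: SL_system_def has_field_derivative_def\<close>)
  have DpDy: "conf_deriv \<kappa>0 \<kappa>1 \<alpha> {a..b} (\<lambda>r. p r * ?Dy r) t = h t - q t * y t"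
    if "t \<in> {a..b}" for t
  proof -
    have "vector_derivative (\<lambda>r. p r * ?Dy r) (at t within {a..b}) =
        (h t - q t * y t - \<kappa>1 \<alpha> t * z t) / \<kappa>0 \<alpha> t"
      using dpDy[OF that] that ab
      by (intro vector_derivative_within_closed_interval)
         (auto simp: has_real_derivative_iff_has_vector_derivative)
    then show ?thesis using \<kappa>0_nz[OF that] by (simp add: conf_deriv_def[of _ _ _ _ "\<lambda>r. p r * ?Dy r"] pDy[OF that])
  qed
  have "continuous_on {a..b} (\<lambda>t. z t / p t)"
    by (intro continuous_intros cont cont_p) (use p_nz in auto)
  then have "continuous_on {a..b} ?Dy"
    using SL_system_conf_deriv[OF sys] by (subst continuous_on_cong[OF refl]) auto
  moreover have "continuous_on {a..b} (\<lambda>t. h t - q t * y t)"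
    by (intro continuous_intros cont cont_q h)
  then have "continuous_on {a..b} (conf_deriv \<kappa>0 \<kappa>1 \<alpha> {a..b} (\<lambda>r. p r * ?Dy r))"
    using DpDy by (subst continuous_on_cong[OF refl]) auto
  moreover have "y differentiable_on {a..b}" "(\<lambda>r. p r * ?Dy r) differentiable_on {a..b}"
    using sys dpDy real_differentiable_def unfolding differentiable_on_def SL_system_def by blast+
  ultimately show ?thesis
    using cont DpDy by (simp add: SL_solution_def Let_def conf_SL_op_def)
qed

text \<open>Restricts a solution on a larger set, such as a Cauchy function on \<open>I\<close>, to
  \<open>[a, b]\<close>, while \<open>z\<close> keeps the derivative within
  \<open>J\<close>.\<close>

lemma SL_solution_imp_system:
  assumes sol: "SL_solution \<kappa>0 \<kappa>1 \<alpha> p q J h y" and J: "{a..b} \<subseteq> J"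
  shows "SL_system h y (\<lambda>r. p r * conf_deriv \<kappa>0 \<kappa>1 \<alpha> J y r)"
  using SL_solution_imp_derivs[OF sol] J \<kappa>0_nz p_nz
  unfolding SL_system_def by (blast intro: DERIV_subset)

lemma BVP_solution_iff_system:
  assumes "continuous_on {a..b} h"
  shows "BVP_solution \<kappa>0 \<kappa>1 \<alpha> p q a b \<xi> \<beta> \<gamma> \<delta> h A B y \<longleftrightarrow>
    (\<exists>z. SL_system h y z \<and> \<xi> * y a - \<beta> * (z a / p a) = A \<and> \<gamma> * y b + \<delta> * (z b / p b) = B)"
    (is "?L \<longleftrightarrow> ?R")
proof
  assume L: ?L
  then have "SL_system h y (\<lambda>r. p r * conf_deriv \<kappa>0 \<kappa>1 \<alpha> {a..b} y r)"
    by (intro SL_solution_imp_system) (auto simp: BVP_solution_def)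
  moreover have "p a \<noteq> 0" "p b \<noteq> 0" using p_nz ab by auto
  ultimately show ?R using L
    by (intro exI[of _ "\<lambda>r. p r * conf_deriv \<kappa>0 \<kappa>1 \<alpha> {a..b} y r"]) (auto simp: BVP_solution_def)
next
  assume ?R
  then show ?L using SL_system_imp_solution[OF _ assms] SL_system_conf_deriv ab
    by (auto simp: BVP_solution_def)
qed

text \<open>The difference of two solutions solves the homogeneous problem, so it vanishes.\<close>

lemma unique_BVP_solutionI:
  assumes "BVP_solution \<kappa>0 \<kappa>1 \<alpha> p q a b \<xi> \<beta> \<gamma> \<delta> h A B y" "continuous_on {a..b} h"
    and triv: "\<forall>y. BVP_solution \<kappa>0 \<kappa>1 \<alpha> p q a b \<xi> \<beta> \<gamma> \<delta> (\<lambda>_. 0) 0 0 y \<longrightarrow> (\<forall>t\<in>{a..b}. y t = 0)"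
  shows "unique_BVP_solution \<kappa>0 \<kappa>1 \<alpha> p q a b \<xi> \<beta> \<gamma> \<delta> h A B y"
  unfolding unique_BVP_solution_def
proof (intro conjI allI impI)
  fix w assume "BVP_solution \<kappa>0 \<kappa>1 \<alpha> p q a b \<xi> \<beta> \<gamma> \<delta> h A B w"
  then obtain z z' where sys: "SL_system h w z" "SL_system h y z'"
    and bc: "\<xi> * w a - \<beta> * (z a / p a) = A" "\<gamma> * w b + \<delta> * (z b / p b) = B"
      "\<xi> * y a - \<beta> * (z' a / p a) = A" "\<gamma> * y b + \<delta> * (z' b / p b) = B"
    using assms(1) by (auto simp: BVP_solution_iff_system[OF assms(2)])
  have "SL_system (\<lambda>_. 0) (\<lambda>t. w t - y t) (\<lambda>t. z t - z' t)"
    using SL_system_linear[OF sys, of 1 "-1"] by simp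
  moreover have "\<xi> * (w a - y a) - \<beta> * ((z a - z' a) / p a) = 0"
    "\<gamma> * (w b - y b) + \<delta> * ((z b - z' b) / p b) = 0"
    using bc by (simp_all add: diff_divide_distrib right_diff_distrib)
  ultimately have "BVP_solution \<kappa>0 \<kappa>1 \<alpha> p q a b \<xi> \<beta> \<gamma> \<delta> (\<lambda>_. 0) 0 0 (\<lambda>t. w t - y t)"
    by (subst BVP_solution_iff_system) auto
  with triv show "\<forall>t\<in>{a..b}. w t = y t" by fastforce
qed (fact assms(1))

section \<open>Wronskians, bases of solutions and variation of constants\<close>

text \<open>Abel's identity: in the product rule the terms with \<open>p\<close> and
  \<open>q\<close> cancel. Here \<open>y'\<close>, \<open>z'\<close> belong to a second solution and
  are not derivatives.\<close>

lemma Wronskian_deriv: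
  assumes "SL_system (\<lambda>_. 0) y z" "SL_system (\<lambda>_. 0) y' z'" and t: "t \<in> {a..b}"
  shows "((\<lambda>t. y t * z' t - z t * y' t) has_real_derivative
     - 2 * \<kappa>1 \<alpha> t / \<kappa>0 \<alpha> t * (y t * z' t - z t * y' t)) (at t within {a..b})"
proof -
  note D = assms(1,2)[unfolded SL_system_def, rule_format, OF t]
  note [derivative_intros] = D(1)[THEN conjunct1] D(1)[THEN conjunct2]
    D(2)[THEN conjunct1] D(2)[THEN conjunct2]
  show ?thesis
    by (auto intro!: derivative_eq_intros simp: \<kappa>0_nz[OF t] p_nz[OF t] field_simps)
qed

text \<open>The integrating factor \<open>exp (integral {a..t} ?k)\<close> turns the Wronskian into
  a constant, which is nonzero because it is so at \<open>c\<close>.\<close>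

lemma Wronskian_nonzero:
  assumes sys: "SL_system (\<lambda>_. 0) y z" "SL_system (\<lambda>_. 0) y' z'"
    and c: "c \<in> {a..b}" "y c * z' c - z c * y' c \<noteq> 0" and t: "t \<in> {a..b}"
  shows "y t * z' t - z t * y' t \<noteq> 0"
proof -
  let ?k = "\<lambda>t. 2 * \<kappa>1 \<alpha> t / \<kappa>0 \<alpha> t"
  let ?E = "\<lambda>t. exp (integral {a..t} ?k) * (y t * z' t - z t * y' t)"
  have k: "continuous_on {a..b} ?k"
    by (intro continuous_intros cont_\<kappa>1 cont_\<kappa>0) (use \<kappa>0_nz in auto)
  have "(?E has_real_derivative 0) (at r within {a..b})" if r: "r \<in> {a..b}" for r
  proof -
    note [derivative_intros] = Wronskian_deriv[OF sys r] integral_has_real_derivative[OF k r]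
    show ?thesis by (auto intro!: derivative_eq_intros)
  qed
  then obtain C where C: "\<And>r. r \<in> {a..b} \<Longrightarrow> ?E r = C"
    using has_field_derivative_zero_constant[of "{a..b}" ?E] by auto
  have "?E t = ?E c" using C t c(1) by metis
  moreover have "?E c \<noteq> 0" using c(2) by simp
  ultimately have "?E t \<noteq> 0" by metis
  then show ?thesis by simp
qed

text \<open>
  All Wronskians satisfy the same linear equation, so the quotients
  \<open>W(y, y2) / W(y1, y2)\<close> and \<open>W(y1, y) / W(y1, y2)\<close> are constant; they are
  the coefficients of \<open>y\<close> (Cramer's rule).
\<close>

lemma SL_system_basis:
  assumes sys1: "SL_system (\<lambda>_. 0) y1 z1" and sys2: "SL_system (\<lambda>_. 0) y2 z2"
    and sys: "SL_system (\<lambda>_. 0) y z"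
    and W: "\<And>t. t \<in> {a..b} \<Longrightarrow> y1 t * z2 t - z1 t * y2 t \<noteq> 0"
  obtains c d where "\<And>t. t \<in> {a..b} \<Longrightarrow> y t = c * y1 t + d * y2 t"
    "\<And>t. t \<in> {a..b} \<Longrightarrow> z t = c * z1 t + d * z2 t"
proof -
  have quot: "\<exists>C. \<forall>t\<in>{a..b}. (f t * g' t - f' t * g t) / (y1 t * z2 t - z1 t * y2 t) = C"
    if "SL_system (\<lambda>_. 0) f f'" "SL_system (\<lambda>_. 0) g g'" for f f' g g'
  proof -
    have "((\<lambda>t. (f t * g' t - f' t * g t) / (y1 t * z2 t - z1 t * y2 t)) has_real_derivative 0)
        (at t within {a..b})" if t: "t \<in> {a..b}" for t
      using DERIV_divide[OF Wronskian_deriv[OF \<open>SL_system _ f f'\<close> \<open>SL_system _ g g'\<close> t]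
          Wronskian_deriv[OF sys1 sys2 t] W[OF t]]
      by (simp add: mult_ac)
    then show ?thesis
      using has_field_derivative_zero_constant[of "{a..b}"
          "\<lambda>t. (f t * g' t - f' t * g t) / (y1 t * z2 t - z1 t * y2 t)"] by auto
  qed
  obtain c where c: "\<And>t. t \<in> {a..b} \<Longrightarrow> (y t * z2 t - z t * y2 t) / (y1 t * z2 t - z1 t * y2 t) = c"
    using quot[OF sys sys2] by auto
  obtain d where d: "\<And>t. t \<in> {a..b} \<Longrightarrow> (y1 t * z t - z1 t * y t) / (y1 t * z2 t - z1 t * y2 t) = d"
    using quot[OF sys1 sys] by auto
  show thesis
  proof
    fix t assume t: "t \<in> {a..b}"
    show "y t = c * y1 t + d * y2 t"
      unfolding c[OF t, symmetric] d[OF t, symmetric] using W[OF t]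
      by (simp add: divide_simps) (simp add: algebra_simps)
    show "z t = c * z1 t + d * z2 t"
      unfolding c[OF t, symmetric] d[OF t, symmetric] using W[OF t]
      by (simp add: divide_simps) (simp add: algebra_simps)
  qed
qed

text \<open>The conditions at \<open>s\<close> form a 2 by 2 linear system for the coefficients of
  \<open>y\<close>, with the Wronskian at \<open>s\<close> as determinant. The value
  \<open>z s = 1\<close> encodes \<open>D y(s) = 1 / p(s)\<close>.\<close>

lemma Cauchy_function_formula:
  assumes sys1: "SL_system (\<lambda>_. 0) y1 z1" and sys2: "SL_system (\<lambda>_. 0) y2 z2"
    and sys: "SL_system (\<lambda>_. 0) y z"
    and W: "\<And>t. t \<in> {a..b} \<Longrightarrow> y1 t * z2 t - z1 t * y2 t \<noteq> 0"
    and s: "s \<in> {a..b}" "y s = 0" "z s = 1" and t: "t \<in> {a..b}"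
  shows "y t = - y2 s / (y1 s * z2 s - z1 s * y2 s) * y1 t + y1 s / (y1 s * z2 s - z1 s * y2 s) * y2 t"
    and "z t = - y2 s / (y1 s * z2 s - z1 s * y2 s) * z1 t + y1 s / (y1 s * z2 s - z1 s * y2 s) * z2 t"
proof -
  obtain c d where cd: "\<And>t. t \<in> {a..b} \<Longrightarrow> y t = c * y1 t + d * y2 t"
    "\<And>t. t \<in> {a..b} \<Longrightarrow> z t = c * z1 t + d * z2 t"
    using SL_system_basis[OF sys1 sys2 sys W] by blast
  have eqs: "c * y1 s + d * y2 s = 0" "c * z1 s + d * z2 s = 1"
    using cd[OF s(1)] s by auto
  have "c * (y1 s * z2 s - z1 s * y2 s) = - y2 s" "d * (y1 s * z2 s - z1 s * y2 s) = y1 s"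
    using eqs by algebra+
  then have "c = - y2 s / (y1 s * z2 s - z1 s * y2 s)" "d = y1 s / (y1 s * z2 s - z1 s * y2 s)"
    using W[OF s(1)] by (metis nonzero_eq_divide_eq)+
  then show "y t = - y2 s / (y1 s * z2 s - z1 s * y2 s) * y1 t + y1 s / (y1 s * z2 s - z1 s * y2 s) * y2 t"
    "z t = - y2 s / (y1 s * z2 s - z1 s * y2 s) * z1 t + y1 s / (y1 s * z2 s - z1 s * y2 s) * z2 t"
    using cd[OF t] by auto
qed

text \<open>The coefficients are antiderivatives of \<open>f1\<close> and \<open>f2\<close>.
  Differentiating them adds nothing to the first equation by \<open>eqy\<close> and exactly the
  forcing term to the second by \<open>eqz\<close>.\<close>

lemma variation_of_constants:
  assumes sys1: "SL_system (\<lambda>_. 0) y1 z1" and sys2: "SL_system (\<lambda>_. 0) y2 z2"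
    and f1: "continuous_on {a..b} f1" and f2: "continuous_on {a..b} f2"
    and eqy: "\<And>t. t \<in> {a..b} \<Longrightarrow> f1 t * y1 t + f2 t * y2 t = 0"
    and eqz: "\<And>t. t \<in> {a..b} \<Longrightarrow> f1 t * z1 t + f2 t * z2 t = h t / \<kappa>0 \<alpha> t"
  shows "SL_system h (\<lambda>t. integral {a..t} f1 * y1 t + integral {a..t} f2 * y2 t)
    (\<lambda>t. integral {a..t} f1 * z1 t + integral {a..t} f2 * z2 t)"
  unfolding SL_system_def
proof (intro ballI conjI)
  fix t assume t: "t \<in> {a..b}"
  let ?F1 = "\<lambda>t. integral {a..t} f1" and ?F2 = "\<lambda>t. integral {a..t} f2"
  note D = sys1[unfolded SL_system_def, rule_format, OF t] sys2[unfolded SL_system_def, rule_format, OF t]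
  note [derivative_intros] = D(1)[THEN conjunct1] D(1)[THEN conjunct2]
    D(2)[THEN conjunct1] D(2)[THEN conjunct2]
    integral_has_real_derivative[OF f1 t] integral_has_real_derivative[OF f2 t]
  \<comment> \<open>The product rule, with the terms that differentiate the integrals collected in
    front.\<close>
  have "((\<lambda>t. ?F1 t * y1 t + ?F2 t * y2 t) has_real_derivative
      (f1 t * y1 t + f2 t * y2 t) +
      ((?F1 t * z1 t + ?F2 t * z2 t) / p t - \<kappa>1 \<alpha> t * (?F1 t * y1 t + ?F2 t * y2 t)) / \<kappa>0 \<alpha> t)
      (at t within {a..b})"
    by (auto intro!: derivative_eq_intros simp: \<kappa>0_nz[OF t] p_nz[OF t] field_simps)
  then show "((\<lambda>t. ?F1 t * y1 t + ?F2 t * y2 t) has_real_derivative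
      ((?F1 t * z1 t + ?F2 t * z2 t) / p t - \<kappa>1 \<alpha> t * (?F1 t * y1 t + ?F2 t * y2 t)) / \<kappa>0 \<alpha> t)
      (at t within {a..b})"
    using eqy[OF t] by simp
  have "((\<lambda>t. ?F1 t * z1 t + ?F2 t * z2 t) has_real_derivative
      (f1 t * z1 t + f2 t * z2 t) +
      (- q t * (?F1 t * y1 t + ?F2 t * y2 t) - \<kappa>1 \<alpha> t * (?F1 t * z1 t + ?F2 t * z2 t)) / \<kappa>0 \<alpha> t)
      (at t within {a..b})"
    by (auto intro!: derivative_eq_intros simp: \<kappa>0_nz[OF t] field_simps)
  then show "((\<lambda>t. ?F1 t * z1 t + ?F2 t * z2 t) has_real_derivative
      (h t - q t * (?F1 t * y1 t + ?F2 t * y2 t) - \<kappa>1 \<alpha> t * (?F1 t * z1 t + ?F2 t * z2 t)) / \<kappa>0 \<alpha> t)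
      (at t within {a..b})"
    unfolding eqz[OF t] by (simp add: diff_divide_distrib add_divide_distrib algebra_simps)
qed

section \<open>Solutions from the Cauchy function and the boundary conditions\<close>

text \<open>Compared with the zero solution: \<open>z / p\<close> is the conformable derivative of
  \<open>y\<close>, hence that of the zero function.\<close>

lemma SL_system_trivial:
  assumes "SL_system (\<lambda>_. 0) y z" "\<And>t. t \<in> {a..b} \<Longrightarrow> y t = 0" and t: "t \<in> {a..b}"
  shows "z t = 0"
proof -
  have "SL_system (\<lambda>_. 0) (\<lambda>_. 0) z"
    by (rule SL_system_cong[OF assms(1)]) (use assms(2) in auto)
  moreover have "SL_system (\<lambda>_. 0) (\<lambda>_. 0) (\<lambda>_. 0)"
    by (simp add: SL_system_def)
  ultimately have "z t / p t = 0 / p t"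
    using SL_system_conf_deriv[OF _ t] by metis
  then show ?thesis using p_nz[OF t] by simp
qed

text \<open>If \<open>x(., a)\<close> vanished on \<open>[a, b]\<close>, so would
  \<open>x' a a\<close>, which is 1. So \<open>x c a\<close> is nonzero for some \<open>c\<close>,
  and it is the Wronskian of \<open>x(., a)\<close> and \<open>x(., c)\<close> at
  \<open>c\<close>.\<close>

lemma fundamental_system_from_Cauchy_function:
  assumes cf: "\<And>s. s \<in> {a..b} \<Longrightarrow> SL_system (\<lambda>_. 0) (\<lambda>t. x t s) (\<lambda>t. x' t s)"
    "\<And>s. s \<in> {a..b} \<Longrightarrow> x s s = 0" "\<And>s. s \<in> {a..b} \<Longrightarrow> x' s s = 1"
  obtains y1 z1 y2 z2 where "SL_system (\<lambda>_. 0) y1 z1" "SL_system (\<lambda>_. 0) y2 z2"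
    "\<And>t. t \<in> {a..b} \<Longrightarrow> y1 t * z2 t - z1 t * y2 t \<noteq> 0"
proof -
  have a: "a \<in> {a..b}" using ab by simp
  have "\<exists>c\<in>{a..b}. x c a \<noteq> 0"
    using SL_system_trivial[OF cf(1)[OF a] _ a] cf(3)[OF a] by (metis zero_neq_one)
  then obtain c where c: "c \<in> {a..b}" "x c a \<noteq> 0" by blast
  show thesis
    by (rule that[OF cf(1)[OF a] cf(1)[OF c(1)] Wronskian_nonzero[OF cf(1)[OF a] cf(1)[OF c(1)] c(1)]])
       (use c cf(2,3)[OF c(1)] in auto)
qed

lemma solution_of_left_boundary_condition:
  assumes sys1: "SL_system (\<lambda>_. 0) y1 z1" and sys2: "SL_system (\<lambda>_. 0) y2 z2"
    and W: "\<And>t. t \<in> {a..b} \<Longrightarrow> y1 t * z2 t - z1 t * y2 t \<noteq> 0"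
    and triv: "\<forall>y. BVP_solution \<kappa>0 \<kappa>1 \<alpha> p q a b \<xi> \<beta> \<gamma> \<delta> (\<lambda>_. 0) 0 0 y \<longrightarrow> (\<forall>t\<in>{a..b}. y t = 0)"
  obtains \<phi> \<phi>' where "SL_system (\<lambda>_. 0) \<phi> \<phi>'"
    "\<xi> * \<phi> a - \<beta> * (\<phi>' a / p a) = 0" "\<gamma> * \<phi> b + \<delta> * (\<phi>' b / p b) \<noteq> 0"
proof -
  define A1 A2 where "A1 = \<xi> * y1 a - \<beta> * (z1 a / p a)" and "A2 = \<xi> * y2 a - \<beta> * (z2 a / p a)"
  \<comment> \<open>A nontrivial kernel element of the left boundary functional, whose values on the
    basis are \<open>A1\<close> and \<open>A2\<close>.\<close>
  obtain c d where cd: "c * A1 + d * A2 = 0" "c \<noteq> 0 \<or> d \<noteq> 0"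
  proof (cases "A2 = 0")
    case True then show thesis using that[of 0 1] by simp
  next
    case False then show thesis using that[of A2 "- A1"] by simp
  qed
  let ?\<phi> = "\<lambda>t. c * y1 t + d * y2 t" and ?\<phi>' = "\<lambda>t. c * z1 t + d * z2 t"
  have sys: "SL_system (\<lambda>_. 0) ?\<phi> ?\<phi>'"
    using SL_system_linear[OF sys1 sys2, of c d] by simp
  have bca: "\<xi> * ?\<phi> a - \<beta> * (?\<phi>' a / p a) = 0"
    using cd(1) by (simp add: A1_def A2_def add_divide_distrib algebra_simps)
  show thesis
  proof (rule that[OF sys bca], rule notI)
    assume "\<gamma> * ?\<phi> b + \<delta> * (?\<phi>' b / p b) = 0"
    with sys bca have "BVP_solution \<kappa>0 \<kappa>1 \<alpha> p q a b \<xi> \<beta> \<gamma> \<delta> (\<lambda>_. 0) 0 0 ?\<phi>"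
      by (subst BVP_solution_iff_system) (auto intro!: exI[of _ ?\<phi>'])
    with triv have \<phi>: "?\<phi> t = 0" if "t \<in> {a..b}" for t using that by blast
    have a: "a \<in> {a..b}" using ab by simp
    have \<phi>': "?\<phi>' a = 0" by (rule SL_system_trivial[OF sys \<phi> a])
    \<comment> \<open>Elimination from \<open>?\<phi> a = 0\<close> and
      \<open>?\<phi>' a = 0\<close>; the nonzero Wronskian then forces both coefficients to
      vanish.\<close>
    have "c * (y1 a * z2 a - z1 a * y2 a) = 0" "d * (y1 a * z2 a - z1 a * y2 a) = 0"
      using \<phi>[OF a] \<phi>' by algebra+
    then show False using cd(2) W[OF a] by simp
  qed
qed

text \<open>Scaling \<phi> preserves the left condition and reaches any value \<open>B\<close> of
  the right functional, which is nonzero on \<phi>.\<close>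

lemma Cauchy_boundary_problem_solution:
  assumes "SL_system (\<lambda>_. 0) \<phi> \<phi>'"
    and "\<xi> * \<phi> a - \<beta> * (\<phi>' a / p a) = 0" "\<gamma> * \<phi> b + \<delta> * (\<phi>' b / p b) \<noteq> 0"
  shows "BVP_solution \<kappa>0 \<kappa>1 \<alpha> p q a b \<xi> \<beta> \<gamma> \<delta> (\<lambda>_. 0) 0 B
    (\<lambda>t. B / (\<gamma> * \<phi> b + \<delta> * (\<phi>' b / p b)) * \<phi> t)"
proof -
  define r where "r = \<gamma> * \<phi> b + \<delta> * (\<phi>' b / p b)"
  have "SL_system (\<lambda>_. 0) (\<lambda>t. B / r * \<phi> t) (\<lambda>t. B / r * \<phi>' t)"
    using SL_system_linear[OF assms(1,1), of "B / r" 0] by simp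
  moreover have "\<xi> * (B / r * \<phi> a) - \<beta> * (B / r * \<phi>' a / p a) =
      B / r * (\<xi> * \<phi> a - \<beta> * (\<phi>' a / p a))"
    "\<gamma> * (B / r * \<phi> b) + \<delta> * (B / r * \<phi>' b / p b) = B / r * (\<gamma> * \<phi> b + \<delta> * (\<phi>' b / p b))"
    by (simp_all only: divide_inverse ring_distribs mult_ac)
  ultimately show ?thesis
    using assms(2,3) unfolding r_def[symmetric] by (subst BVP_solution_iff_system) (auto intro!: exI[of _ "\<lambda>t. B / r * \<phi>' t"])
qed

section \<open>The integral of Green's function against \<open>h\<close>\<close>

text \<open>Since \<open>G = u + x\<close> for \<open>s \<le> t\<close> and \<open>G = u\<close>
  otherwise, \<open>u\<close> is integrated over \<open>[a, b]\<close>, giving a multiple of \<phi>,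
  and \<open>x\<close> over \<open>[a, t]\<close>, giving a particular solution. Integrability is
  stated separately because \<open>integral\<close> is 0 by default on nonintegrable
  functions.\<close>

lemma Green_function_solution:
  assumes cf: "\<And>s. s \<in> {a..b} \<Longrightarrow> SL_system (\<lambda>_. 0) (\<lambda>t. x t s) (\<lambda>t. x' t s)"
    "\<And>s. s \<in> {a..b} \<Longrightarrow> x s s = 0" "\<And>s. s \<in> {a..b} \<Longrightarrow> x' s s = 1"
    and triv: "\<forall>y. BVP_solution \<kappa>0 \<kappa>1 \<alpha> p q a b \<xi> \<beta> \<gamma> \<delta> (\<lambda>_. 0) 0 0 y \<longrightarrow> (\<forall>t\<in>{a..b}. y t = 0)"
    and u: "\<And>s. s \<in> {a..b} \<Longrightarrow> BVP_solution \<kappa>0 \<kappa>1 \<alpha> p q a b \<xi> \<beta> \<gamma> \<delta> (\<lambda>_. 0)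
      0 (- (\<gamma> * x b s + \<delta> * (x' b s / p b))) (\<lambda>t. u t s)"
    and v: "\<And>t s. t \<in> {a..b} \<Longrightarrow> s \<in> {a..b} \<Longrightarrow> v t s = u t s + x t s"
    and h: "continuous_on {a..b} h"
  defines "X \<equiv> \<lambda>t. integral {a..b} (\<lambda>s. Green_function u v t s * h s / \<kappa>0 \<alpha> s)"
  shows "t \<in> {a..b} \<Longrightarrow> (\<lambda>s. Green_function u v t s * h s / \<kappa>0 \<alpha> s) integrable_on {a..b}"
    and "BVP_solution \<kappa>0 \<kappa>1 \<alpha> p q a b \<xi> \<beta> \<gamma> \<delta> h 0 0 X"
proof -
  obtain y1 z1 y2 z2 where sys1: "SL_system (\<lambda>_. 0) y1 z1" and sys2: "SL_system (\<lambda>_. 0) y2 z2"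
    and W: "\<And>t. t \<in> {a..b} \<Longrightarrow> y1 t * z2 t - z1 t * y2 t \<noteq> 0"
    using fundamental_system_from_Cauchy_function[OF cf] by blast
  obtain \<phi> \<phi>' where \<phi>: "SL_system (\<lambda>_. 0) \<phi> \<phi>'"
    and bca: "\<xi> * \<phi> a - \<beta> * (\<phi>' a / p a) = 0" and bcb: "\<gamma> * \<phi> b + \<delta> * (\<phi>' b / p b) \<noteq> 0"
    using solution_of_left_boundary_condition[OF sys1 sys2 W triv] by blast
  \<comment> \<open>\<open>r\<close>, \<open>B1\<close> and \<open>B2\<close> are the values of the
    right boundary functional on \<phi>, \<open>y1\<close> and \<open>y2\<close>.\<close>
  define r where "r = \<gamma> * \<phi> b + \<delta> * (\<phi>' b / p b)"
  define B1 B2 where "B1 = \<gamma> * y1 b + \<delta> * (z1 b / p b)" and "B2 = \<gamma> * y2 b + \<delta> * (z2 b / p b)"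
  define w where "w s = y1 s * z2 s - z1 s * y2 s" for s
  \<comment> \<open>Chosen so that \<open>x t s * (h s / \<kappa>0 \<alpha> s) = f1 s * y1 t + f2 s
    * y2 t\<close>, which separates \<open>s\<close> from \<open>t\<close>.\<close>
  define f1 f2 where "f1 s = - y2 s / w s * (h s / \<kappa>0 \<alpha> s)" and "f2 s = y1 s / w s * (h s / \<kappa>0 \<alpha> s)" for s
  have w: "w s \<noteq> 0" if "s \<in> {a..b}" for s using W[OF that] by (simp add: w_def)
  have x: "x t s = - y2 s / w s * y1 t + y1 s / w s * y2 t"
    and x': "x' t s = - y2 s / w s * z1 t + y1 s / w s * z2 t"
    if "t \<in> {a..b}" "s \<in> {a..b}" for t s
    using Cauchy_function_formula[OF sys1 sys2 cf(1)[OF that(2)] W that(2) cf(2)[OF that(2)]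
        cf(3)[OF that(2)] that(1)] by (simp_all add: w_def)
  have contw: "continuous_on {a..b} w"
    unfolding w_def by (intro continuous_intros SL_system_cont[OF sys1] SL_system_cont[OF sys2])
  have f1: "continuous_on {a..b} f1" and f2: "continuous_on {a..b} f2"
    unfolding f1_def f2_def
    by (intro continuous_intros SL_system_cont[OF sys1] SL_system_cont[OF sys2] contw h cont_\<kappa>0;
        use w \<kappa>0_nz in auto)+
  have b: "b \<in> {a..b}" and a: "a \<in> {a..b}" using ab by auto
  have bx: "(\<gamma> * x b s + \<delta> * (x' b s / p b)) * (h s / \<kappa>0 \<alpha> s) = B1 * f1 s + B2 * f2 s"
    if s: "s \<in> {a..b}" for s
    unfolding x[OF b s] x'[OF b s] B1_def B2_def f1_def f2_def
    by (simp add: add_divide_distrib diff_divide_distrib algebra_simps)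
  \<comment> \<open>Uniqueness identifies \<open>u(., s)\<close> with a multiple of \<phi>; this
    also makes the integrand continuous in \<open>s\<close>.\<close>
  have u: "u t s * (h s / \<kappa>0 \<alpha> s) = - \<phi> t / r * (B1 * f1 s + B2 * f2 s)"
    if t: "t \<in> {a..b}" and s: "s \<in> {a..b}" for t s
  proof -
    let ?B = "- (\<gamma> * x b s + \<delta> * (x' b s / p b))"
    have "unique_BVP_solution \<kappa>0 \<kappa>1 \<alpha> p q a b \<xi> \<beta> \<gamma> \<delta> (\<lambda>_. 0) 0 ?B (\<lambda>t. ?B / r * \<phi> t)"
      unfolding r_def
      by (intro unique_BVP_solutionI Cauchy_boundary_problem_solution[OF \<phi> bca bcb] triv) auto
    then have "u t s = ?B / r * \<phi> t"
      using u[OF s] t unfolding unique_BVP_solution_def by blast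
    then have "u t s * (h s / \<kappa>0 \<alpha> s) = - \<phi> t / r * ((\<gamma> * x b s + \<delta> * (x' b s / p b)) * (h s / \<kappa>0 \<alpha> s))"
      by (simp only: divide_inverse minus_mult_left[symmetric] minus_mult_right[symmetric] mult_ac)
    then show ?thesis unfolding bx[OF s] .
  qed
  define F1 F2 where "F1 t = integral {a..t} f1" and "F2 t = integral {a..t} f2" for t
  \<comment> \<open>The coefficient of \<phi> left by integrating the part with \<open>u\<close>.
    Its boundary value \<open>K * r\<close> is minus that of the particular solution at
    \<open>b\<close>.\<close>
  define K where "K = - (B1 * F1 b + B2 * F2 b) / r"
  have int: "(f1 has_integral F1 t) {a..t}" "(f2 has_integral F2 t) {a..t}" if "t \<in> {a..b}" for t
    unfolding F1_def F2_def using that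
    by (auto intro!: integrable_integral integrable_continuous_interval
        continuous_on_subset[OF f1] continuous_on_subset[OF f2])
  have G: "((\<lambda>s. Green_function u v t s * h s / \<kappa>0 \<alpha> s) has_integral
      1 * (K * \<phi> t) + 1 * (F1 t * y1 t + F2 t * y2 t)) {a..b}" if t: "t \<in> {a..b}" for t
  proof -
    have "((\<lambda>s. - \<phi> t / r * (B1 * f1 s + B2 * f2 s)) has_integral
        - \<phi> t / r * (B1 * F1 b + B2 * F2 b)) {a..b}"
      by (intro has_integral_mult_right has_integral_add int b)
    then have "((\<lambda>s. - \<phi> t / r * (B1 * f1 s + B2 * f2 s)) has_integral K * \<phi> t) {a..b}"
      by (simp only: K_def divide_inverse minus_mult_left[symmetric] minus_mult_right[symmetric] mult_ac)
    \<comment> \<open>Extension by zero moves the integral over \<open>[a, t]\<close> to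
      \<open>[a, b]\<close>, where both parts can be added.\<close>
    moreover have "((\<lambda>s. if s \<in> {a..t} then f1 s * y1 t + f2 s * y2 t else 0) has_integral
        F1 t * y1 t + F2 t * y2 t) {a..b}"
      using t by (subst has_integral_restrict) (auto intro!: has_integral_add has_integral_mult_left int)
    ultimately have "((\<lambda>s. - \<phi> t / r * (B1 * f1 s + B2 * f2 s) +
        (if s \<in> {a..t} then f1 s * y1 t + f2 s * y2 t else 0)) has_integral
        1 * (K * \<phi> t) + 1 * (F1 t * y1 t + F2 t * y2 t)) {a..b}"
      unfolding mult_1 by (rule has_integral_add)
    then show ?thesis
    proof (rule has_integral_eq[rotated])
      fix s assume s: "s \<in> {a..b}"
      have xf: "x t s * (h s / \<kappa>0 \<alpha> s) = f1 s * y1 t + f2 s * y2 t"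
        unfolding x[OF t s] f1_def f2_def by (simp only: ring_distribs mult_ac)
      \<comment> \<open>At \<open>s = t\<close> the definition takes the branch \<open>u\<close> and
        the right side takes \<open>u + x\<close>; they agree because
        \<open>x s s = 0\<close>.\<close>
      have "Green_function u v t s = u t s + (if s \<le> t then x t s else 0)"
        using v[OF t s] cf(2)[OF s] by (auto simp: Green_function_def)
      then have "Green_function u v t s * h s / \<kappa>0 \<alpha> s =
          u t s * (h s / \<kappa>0 \<alpha> s) + (if s \<le> t then x t s * (h s / \<kappa>0 \<alpha> s) else 0)"
        by (simp add: distrib_right add_divide_distrib)
      then show "- \<phi> t / r * (B1 * f1 s + B2 * f2 s) +
          (if s \<in> {a..t} then f1 s * y1 t + f2 s * y2 t else 0) =
          Green_function u v t s * h s / \<kappa>0 \<alpha> s"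
        using s unfolding xf u[OF t s] by simp
    qed
  qed
  show "(\<lambda>s. Green_function u v t s * h s / \<kappa>0 \<alpha> s) integrable_on {a..b}" if "t \<in> {a..b}"
    using G[OF that] by blast
  let ?X' = "\<lambda>t. K * \<phi>' t + 1 * (F1 t * z1 t + F2 t * z2 t)"
  \<comment> \<open>The factor 1 is kept to match \<open>SL_system_linear\<close> with coefficients
    \<open>K\<close> and 1.\<close>
  have X: "X t = K * \<phi> t + 1 * (F1 t * y1 t + F2 t * y2 t)" if "t \<in> {a..b}" for t
    unfolding X_def using integral_unique[OF G[OF that]] by simp
  have "SL_system h (\<lambda>t. F1 t * y1 t + F2 t * y2 t) (\<lambda>t. F1 t * z1 t + F2 t * z2 t)"
    unfolding F1_def F2_def
  proof (rule variation_of_constants[OF sys1 sys2 f1 f2])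
    fix t assume t: "t \<in> {a..b}"
    show "f1 t * y1 t + f2 t * y2 t = 0" by (simp add: f1_def f2_def)
    \<comment> \<open>The counterpart of \<open>x' t t = 1\<close>, as the equation before is that
      of \<open>x t t = 0\<close>.\<close>
    have "f1 t * z1 t + f2 t * z2 t = (y1 t * z2 t - z1 t * y2 t) / w t * (h t / \<kappa>0 \<alpha> t)"
      by (simp add: f1_def f2_def diff_divide_distrib algebra_simps)
    then show "f1 t * z1 t + f2 t * z2 t = h t / \<kappa>0 \<alpha> t"
      using w[OF t] unfolding w_def[symmetric] by simp
  qed
  from SL_system_linear[OF \<phi> this, of K 1] have "SL_system h X ?X'"
    by (rule SL_system_cong) (use X in auto)
  moreover have "\<xi> * X a - \<beta> * (?X' a / p a) = 0"
  proof -
    \<comment> \<open>The particular solution has zero data at \<open>a\<close>, so only the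
      multiple of \<phi> enters the left condition.\<close>
    have "F1 a = 0" "F2 a = 0" by (simp_all add: F1_def F2_def)
    then have "\<xi> * X a - \<beta> * (?X' a / p a) = K * (\<xi> * \<phi> a - \<beta> * (\<phi>' a / p a))"
      unfolding X[OF a] by (simp add: algebra_simps)
    then show ?thesis unfolding bca by simp
  qed
  moreover have "\<gamma> * X b + \<delta> * (?X' b / p b) = 0"
  proof -
    have "\<gamma> * X b + \<delta> * (?X' b / p b) = K * r + (B1 * F1 b + B2 * F2 b)"
      unfolding X[OF b] r_def B1_def B2_def by (simp add: add_divide_distrib algebra_simps)
    then show ?thesis using bcb by (simp add: K_def r_def)
  qed
  ultimately show "BVP_solution \<kappa>0 \<kappa>1 \<alpha> p q a b \<xi> \<beta> \<gamma> \<delta> h 0 0 X"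
    by (subst BVP_solution_iff_system[OF h]) blast
qed

end

section \<open>Passage from the interval \<open>I\<close> to \<open>[a, b]\<close>\<close>

theorem theorem11p4:
  fixes I :: "real set"
    and \<kappa>0 \<kappa>1 :: "real \<Rightarrow> real \<Rightarrow> real"
    and p q :: "real \<Rightarrow> real"
    and \<alpha> a b \<xi> \<beta> \<gamma> \<delta> :: real
    and x :: "real \<Rightarrow> real \<Rightarrow> real"
  assumes "nondegenerate_interval I"
    and "conformable_kernels I \<kappa>0 \<kappa>1"
    and "0 < \<alpha>" and "\<alpha> \<le> 1"
    and "continuous_on I p" and "continuous_on I q"
    and "\<forall>t\<in>I. p t > 0"
    and "a < b" and "{a..b} \<subseteq> I"
    and "Cauchy_function \<kappa>0 \<kappa>1 \<alpha> p q I x"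
    and "\<forall>y. BVP_solution \<kappa>0 \<kappa>1 \<alpha> p q a b \<xi> \<beta> \<gamma> \<delta> (\<lambda>_. 0) 0 0 y \<longrightarrow> (\<forall>t\<in>{a..b}. y t = 0)"
  shows "(\<forall>s\<in>{a..b}. \<exists>w. unique_BVP_solution \<kappa>0 \<kappa>1 \<alpha> p q a b \<xi> \<beta> \<gamma> \<delta> (\<lambda>_. 0)
            0 (- \<gamma> * x b s - \<delta> * conf_deriv \<kappa>0 \<kappa>1 \<alpha> I (\<lambda>t. x t s) b) w) \<and>
    (\<forall>u v :: real \<Rightarrow> real \<Rightarrow> real.
       (\<forall>s\<in>{a..b}. BVP_solution \<kappa>0 \<kappa>1 \<alpha> p q a b \<xi> \<beta> \<gamma> \<delta> (\<lambda>_. 0)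
            0 (- \<gamma> * x b s - \<delta> * conf_deriv \<kappa>0 \<kappa>1 \<alpha> I (\<lambda>t. x t s) b) (\<lambda>t. u t s)) \<longrightarrow>
       (\<forall>t\<in>{a..b}. \<forall>s\<in>{a..b}. v t s = u t s + x t s) \<longrightarrow>
       (\<forall>s\<in>{a..b}.
          SL_solution \<kappa>0 \<kappa>1 \<alpha> p q {a..b} (\<lambda>_. 0) (\<lambda>t. v t s) \<and>
          \<gamma> * v b s + \<delta> * conf_deriv \<kappa>0 \<kappa>1 \<alpha> {a..b} (\<lambda>t. v t s) b = 0) \<and>
       (\<forall>h :: real \<Rightarrow> real. continuous_on {a..b} h \<longrightarrow>
          (\<forall>t\<in>{a..b}. (\<lambda>s. Green_function u v t s * h s / \<kappa>0 \<alpha> s) integrable_on {a..b}) \<and>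
          unique_BVP_solution \<kappa>0 \<kappa>1 \<alpha> p q a b \<xi> \<beta> \<gamma> \<delta> h 0 0
            (\<lambda>t. integral {a..b} (\<lambda>s. Green_function u v t s * h s / \<kappa>0 \<alpha> s))))"
proof -
  have pos: "\<kappa>0 \<alpha> t \<noteq> 0" "p t \<noteq> 0" if "t \<in> I" for t
    using assms(2-4,7) that unfolding conformable_kernels_def by (simp, fastforce)
  have sub: "{a..b} \<subseteq> I" by (fact assms(9))
  have \<alpha>: "\<alpha> \<in> {0..1}" using assms(3,4) by simp
  \<comment> \<open>Joint continuity of the kernels is restricted to the slice at the fixed order
    \<alpha>.\<close>
  have "continuous_on {a..b} (\<lambda>t. f \<alpha> t)" if "continuous_on ({0..1} \<times> I) (\<lambda>(\<alpha>, t). f \<alpha> t)"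
    for f :: "real \<Rightarrow> real \<Rightarrow> real"
  proof -
    have "continuous_on {a..b} (\<lambda>t. (\<alpha>, t))"
      by (intro continuous_intros)
    moreover have "(\<lambda>t. (\<alpha>, t)) ` {a..b} \<subseteq> {0..1} \<times> I"
      using \<alpha> sub by blast
    ultimately show ?thesis using continuous_on_compose2[OF that, of "{a..b}" "Pair \<alpha>"] by simp
  qed
  then have "continuous_on {a..b} (\<kappa>0 \<alpha>)" "continuous_on {a..b} (\<kappa>1 \<alpha>)"
    using assms(2) unfolding conformable_kernels_def by blast+
  then interpret SL_interval \<kappa>0 \<kappa>1 \<alpha> p q a b
    using assms(5,6,8) pos sub by unfold_locales (auto intro: continuous_on_subset)
  \<comment> \<open>\<open>x'\<close> is \<open>p D x\<close> with the derivative within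
    \<open>I\<close>, the second component of the system.\<close>
  define x' where "x' t s = p t * conf_deriv \<kappa>0 \<kappa>1 \<alpha> I (\<lambda>t. x t s) t" for t s
  have b: "b \<in> {a..b}" using assms(8) by simp
  have cf: "SL_system (\<lambda>_. 0) (\<lambda>t. x t s) (\<lambda>t. x' t s)" "x s s = 0" "x' s s = 1" if "s \<in> {a..b}" for s
    using assms(10) that sub pos SL_solution_imp_system[OF _ sub] p_nz[OF that]
    by (auto simp: Cauchy_function_def x'_def)
  \<comment> \<open>Rewrites the boundary value, stated with the derivative within \<open>I\<close>,
    in terms of the system on \<open>[a, b]\<close>.\<close>
  have bx: "- \<gamma> * x b s - \<delta> * conf_deriv \<kappa>0 \<kappa>1 \<alpha> I (\<lambda>t. x t s) b =
      - (\<gamma> * x b s + \<delta> * (x' b s / p b))" for s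
    using p_nz[OF b] by (simp add: x'_def)
  show ?thesis
    unfolding bx
  proof (intro conjI ballI allI impI)
    fix s assume "s \<in> {a..b}"
    obtain y1 z1 y2 z2 where fs: "SL_system (\<lambda>_. 0) y1 z1" "SL_system (\<lambda>_. 0) y2 z2"
      "\<And>t. t \<in> {a..b} \<Longrightarrow> y1 t * z2 t - z1 t * y2 t \<noteq> 0"
      using fundamental_system_from_Cauchy_function[OF cf] by blast
    obtain \<phi> \<phi>' where "SL_system (\<lambda>_. 0) \<phi> \<phi>'"
      "\<xi> * \<phi> a - \<beta> * (\<phi>' a / p a) = 0" "\<gamma> * \<phi> b + \<delta> * (\<phi>' b / p b) \<noteq> 0"
      using solution_of_left_boundary_condition[OF fs assms(11)] by blast
    from unique_BVP_solutionI[OF Cauchy_boundary_problem_solution[OF this] continuous_on_const assms(11)]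
    show "\<exists>w. unique_BVP_solution \<kappa>0 \<kappa>1 \<alpha> p q a b \<xi> \<beta> \<gamma> \<delta> (\<lambda>_. 0)
      0 (- (\<gamma> * x b s + \<delta> * (x' b s / p b))) w" by blast
  next
    fix u v :: "real \<Rightarrow> real \<Rightarrow> real" and s
    assume u: "\<forall>s\<in>{a..b}. BVP_solution \<kappa>0 \<kappa>1 \<alpha> p q a b \<xi> \<beta> \<gamma> \<delta> (\<lambda>_. 0)
        0 (- (\<gamma> * x b s + \<delta> * (x' b s / p b))) (\<lambda>t. u t s)"
      and v: "\<forall>t\<in>{a..b}. \<forall>s\<in>{a..b}. v t s = u t s + x t s" and s: "s \<in> {a..b}"
    obtain u' where u': "SL_system (\<lambda>_. 0) (\<lambda>t. u t s) u'"
      and bcu: "\<gamma> * u b s + \<delta> * (u' b / p b) = - (\<gamma> * x b s + \<delta> * (x' b s / p b))"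
      using u[rule_format, OF s] by (auto simp: BVP_solution_iff_system)
    have sys: "SL_system (\<lambda>_. 0) (\<lambda>t. v t s) (\<lambda>t. u' t + x' t s)"
      by (rule SL_system_cong[OF SL_system_linear[OF u' cf(1)[OF s], of 1 1]]) (use v s in auto)
    then show "SL_solution \<kappa>0 \<kappa>1 \<alpha> p q {a..b} (\<lambda>_. 0) (\<lambda>t. v t s)"
      by (rule SL_system_imp_solution) simp
    show "\<gamma> * v b s + \<delta> * conf_deriv \<kappa>0 \<kappa>1 \<alpha> {a..b} (\<lambda>t. v t s) b = 0"
      \<comment> \<open>The derivative of \<open>v(., s)\<close> within \<open>[a, b]\<close>
        becomes \<open>(u' b + x' b s) / p b\<close>, so the contributions of \<open>u\<close> and
        \<open>x\<close> cancel.\<close>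
      unfolding SL_system_conf_deriv[OF sys b] using bcu v b s
      by (simp add: add_divide_distrib distrib_left)
  next
    fix u v :: "real \<Rightarrow> real \<Rightarrow> real" and h :: "real \<Rightarrow> real" and t
    assume u: "\<forall>s\<in>{a..b}. BVP_solution \<kappa>0 \<kappa>1 \<alpha> p q a b \<xi> \<beta> \<gamma> \<delta> (\<lambda>_. 0)
        0 (- (\<gamma> * x b s + \<delta> * (x' b s / p b))) (\<lambda>t. u t s)"
      and v: "\<forall>t\<in>{a..b}. \<forall>s\<in>{a..b}. v t s = u t s + x t s"
      and h: "continuous_on {a..b} h"
    note G = Green_function_solution[OF cf assms(11) u[rule_format] v[rule_format] h]
    show "(\<lambda>s. Green_function u v t s * h s / \<kappa>0 \<alpha> s) integrable_on {a..b}" if "t \<in> {a..b}"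
      by (rule G(1)) (use that in auto)
    show "unique_BVP_solution \<kappa>0 \<kappa>1 \<alpha> p q a b \<xi> \<beta> \<gamma> \<delta> h 0 0
        (\<lambda>t. integral {a..b} (\<lambda>s. Green_function u v t s * h s / \<kappa>0 \<alpha> s))"
      by (rule unique_BVP_solutionI[OF G(2) h assms(11)])
  qed
qed

end
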